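(* Let $(T,c)$ be an algebraic tree with component topology $\tau$. Then $(T,\tau)$ is compact if and only if $(T,c)$ is directed order complete.
   Context: An algebraic tree $(T,c)$ is a set $T\neq\emptyset$ with a map $c\colon T^3\to T$ such that for all points: $c$ is symmetric; $c(x,y,y)=y$; $c(x,y,c(x,y,z))=c(x,y,z)$; and $c(x_1,x_2,x_3)\in\{c(x_1,x_2,x_4),c(x_1,x_3,x_4),c(x_2,x_3,x_4)\}$. Intervals: $[x,y]:=\{z\in T: c(x,y,z)=z\}$. For $x\neq y$ the component of $T\setminus\{x\}$ containing $y$ is $\mathcal{S}_x(y):=\{z\in T\setminus\{x\}: c(x,y,z)\ne x\}$. The component topology $\tau$ is the coarsest topology on $T$ in which all $\mathcal{S}_x(y)$, $x\ne y$, are open. For $\rho\in T$ let $\le_\rho$ be the partial order $x\le_\rho y:\iff x\in[\rho,y]$. $(T,c)$ is directed order complete if for every $\rho\in T$ every non-empty totally ordered subset of $(T,\le_\rho)$ has a supremum in $(T,\le_\rho)$. *)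

theory Defs
  imports "HOL-Analysis.Analysis"
begin

text \<open>
  The underlying set of the tree is an explicit carrier \<open>T\<close>; the values of \<open>c\<close> outside of
  \<open>T \<times> T \<times> T\<close> are irrelevant. Symmetry is required for the two adjacent transpositions, which
  generate all permutations of the three arguments.
\<close>

locale algebraic_tree =
  fixes T :: "'a set" and c :: "'a \<Rightarrow> 'a \<Rightarrow> 'a \<Rightarrow> 'a"
  assumes nonempty: "T \<noteq> {}"
    and closed: "\<lbrakk>x \<in> T; y \<in> T; z \<in> T\<rbrakk> \<Longrightarrow> c x y z \<in> T"
    and sym12: "\<lbrakk>x \<in> T; y \<in> T; z \<in> T\<rbrakk> \<Longrightarrow> c x y z = c y x z"
    and sym23: "\<lbrakk>x \<in> T; y \<in> T; z \<in> T\<rbrakk> \<Longrightarrow> c x y z = c x z y"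
    and two_point: "\<lbrakk>x \<in> T; y \<in> T\<rbrakk> \<Longrightarrow> c x y y = y"
    and three_point: "\<lbrakk>x \<in> T; y \<in> T; z \<in> T\<rbrakk> \<Longrightarrow> c x y (c x y z) = c x y z"
    and four_point: "\<lbrakk>w \<in> T; x \<in> T; y \<in> T; z \<in> T\<rbrakk> \<Longrightarrow> c w x y \<in> {c w x z, c w y z, c x y z}"

definition tree_interval :: "'a set \<Rightarrow> ('a \<Rightarrow> 'a \<Rightarrow> 'a \<Rightarrow> 'a) \<Rightarrow> 'a \<Rightarrow> 'a \<Rightarrow> 'a set" where
  "tree_interval T c x y = {z \<in> T. c x y z = z}"

text \<open>The component of \<open>T - {x}\<close> containing \<open>y\<close>; only meaningful for \<open>x \<noteq> y\<close>.\<close>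

definition tree_component :: "'a set \<Rightarrow> ('a \<Rightarrow> 'a \<Rightarrow> 'a \<Rightarrow> 'a) \<Rightarrow> 'a \<Rightarrow> 'a \<Rightarrow> 'a set" where
  "tree_component T c x y = {z \<in> T - {x}. c x y z \<noteq> x}"

text \<open>
  The topology generated by a family has the union of the family as its underlying space.
  The set \<open>T\<close> is inserted into the subbasis so that the space is \<open>T\<close> even if \<open>T\<close> is a singleton,
  in which case there are no components.
\<close>

definition component_topology :: "'a set \<Rightarrow> ('a \<Rightarrow> 'a \<Rightarrow> 'a \<Rightarrow> 'a) \<Rightarrow> 'a topology" where
  "component_topology T c =
     topology_generated_by
       (insert T {tree_component T c x y | x y. x \<in> T \<and> y \<in> T \<and> x \<noteq> y})"

lemma topspace_component_topology: "topspace (component_topology T c) = T"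
  unfolding component_topology_def topology_generated_by_topspace
  by (auto simp: tree_component_def)

definition tree_le :: "'a set \<Rightarrow> ('a \<Rightarrow> 'a \<Rightarrow> 'a \<Rightarrow> 'a) \<Rightarrow> 'a \<Rightarrow> 'a \<Rightarrow> 'a \<Rightarrow> bool" where
  "tree_le T c \<rho> x y \<longleftrightarrow> x \<in> tree_interval T c \<rho> y"

definition is_supremum_on :: "'a set \<Rightarrow> ('a \<Rightarrow> 'a \<Rightarrow> bool) \<Rightarrow> 'a set \<Rightarrow> 'a \<Rightarrow> bool" where
  "is_supremum_on T le A s \<longleftrightarrow>
     s \<in> T \<and> (\<forall>a\<in>A. le a s) \<and> (\<forall>u\<in>T. (\<forall>a\<in>A. le a u) \<longrightarrow> le s u)"

definition directed_order_complete :: "'a set \<Rightarrow> ('a \<Rightarrow> 'a \<Rightarrow> 'a \<Rightarrow> 'a) \<Rightarrow> bool" where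
  "directed_order_complete T c \<longleftrightarrow>
     (\<forall>\<rho>\<in>T. \<forall>A. A \<subseteq> T \<and> A \<noteq> {} \<and> Complete_Partial_Order.chain (tree_le T c \<rho>) A
        \<longrightarrow> (\<exists>s. is_supremum_on T (tree_le T c \<rho>) A s))"

end

theory Submission
  imports Defs
begin

text \<open>
  Both up-sets and intervals \<open>[\<rho>, u]\<close> are closed. Hence, in a compact tree, the up-sets of the
  elements of a chain and the intervals from \<open>\<rho>\<close> to its upper bounds have a common point, and any
  such point is a supremum.

  Conversely, by Alexander's subbase theorem it suffices to show that a family of components, any two
  of which fail to cover \<open>T\<close>, does not cover \<open>T\<close>. Fix \<open>\<rho> \<in> T\<close>. If \<open>\<rho>\<close> is covered, the components
  \<open>S\<^sub>x(\<rho>)\<close> in the family are the complements of the up-sets of their base points \<open>x\<close>. Two such up-sets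
  intersect, so the base points form a chain in \<open>\<le>\<^sub>\<rho>\<close>, and its supremum turns out to be an uncovered
  point.
\<close>

section \<open>Alexander's subbase theorem for generated topologies\<close>

lemma Alexander_subbase_topology_generated_by:
  assumes fin: "\<And>\<C>. \<lbrakk>\<C> \<subseteq> \<B>; \<Union>\<C> = \<Union>\<B>\<rbrakk> \<Longrightarrow> \<exists>\<C>'. finite \<C>' \<and> \<C>' \<subseteq> \<C> \<and> \<Union>\<C>' = \<Union>\<B>"
  shows "compact_space (topology_generated_by \<B>)"
proof -
  let ?X = "topology (arbitrary union_of (finite intersection_of (\<lambda>x. x \<in> \<B>) relative_to \<Union>\<B>))"
  have sub: "openin ?X S" if "S \<in> \<B>" for S
  proof -
    have "(finite intersection_of (\<lambda>x. x \<in> \<B>) relative_to \<Union>\<B>) (\<Union>\<B> \<inter> S)"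
      using that by (intro relative_to_inc finite_intersection_of_inc)
    moreover have "\<Union>\<B> \<inter> S = S"
      using that by blast
    ultimately show ?thesis
      unfolding openin_subbase by (metis arbitrary_union_of_inc)
  qed
  \<comment> \<open>Both are the coarsest topology on \<open>\<Union>\<B>\<close> in which the
    members of \<open>\<B>\<close> are open.\<close>
  have "openin (topology_generated_by \<B>) S \<longleftrightarrow> openin ?X S" for S
  proof
    assume "openin (topology_generated_by \<B>) S"
    then show "openin ?X S"
      unfolding openin_topology_generated_by_iff
      by (rule generate_topology_on_coarsest[OF istopology_openin, rotated]) (rule sub)
  next
    assume S: "openin ?X S"
    have "openin (topology_generated_by \<B>) (\<Union>\<B>)"
      by (metis openin_topspace topology_generated_by_topspace)
    from minimal_topology_subbase[OF _ this S] show "openin (topology_generated_by \<B>) S"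
      using topology_generated_by_Basis by blast
  qed
  then have "?X = topology_generated_by \<B>"
    by (simp add: topology_eq)
  then show ?thesis
    by (rule Alexander_subbase) (use fin in simp)
qed

section \<open>Separation by a point and the order at a root\<close>

lemma tree_le_iff: "tree_le T c r x y \<longleftrightarrow> x \<in> T \<and> c r y x = x"
  by (simp add: tree_le_def tree_interval_def)

context algebraic_tree
begin

text \<open>If \<open>x\<close> separated \<open>y\<close> from \<open>w\<close>, then
  \<open>c x y z\<close> and \<open>c x z w\<close> would be one point \<open>m \<noteq> x\<close>,
  between \<open>x\<close> and \<open>y\<close> and also between \<open>x\<close> and
  \<open>w\<close>. Then \<open>x\<close> would lie between \<open>y\<close> and \<open>m\<close>,
  which is absurd.\<close>

lemma same_component_trans:
  assumes T: "x \<in> T" "y \<in> T" "z \<in> T" "w \<in> T"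
    and "c x y z \<noteq> x" "c x z w \<noteq> x"
  shows "c x y w \<noteq> x"
proof
  assume xyw: "c x y w = x"
  define m where "m = c x y z"
  have m: "m \<in> T" "m \<noteq> x" using assms by (auto simp: m_def closed)
  \<comment> \<open>The four-point condition for \<open>c x y w = x\<close> leaves only
    \<open>c y w z = x\<close>; for \<open>m \<noteq> x\<close> it then leaves only
    \<open>c x z w\<close>.\<close>
  have "m = c x z w"
    using four_point[of x y z w] assms four_point[of x y w z] xyw unfolding m_def
    by (smt (verit) insert_iff singletonD sym12 sym23)
  then have "c x y m = m" "c x w m = m"
    using three_point T m sym12 sym23 m_def by metis+
  then have "c y w m = x"
    using four_point[of x y w m] T m xyw by auto
  then have "c y m x = x" using three_point[of y m w] sym23 T m by metis
  then show False using \<open>c x y m = m\<close> m T sym12 sym23 by metis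
qed

lemma tree_component_cong:
  assumes "x \<in> T" "y \<in> T" "z \<in> T" "c x y z \<noteq> x"
  shows "tree_component T c x y = tree_component T c x z"
proof -
  have "c x z y \<noteq> x"
    using assms sym23 by metis
  then show ?thesis
    unfolding tree_component_def using assms same_component_trans by blast
qed

lemma tree_le_refl: "r \<in> T \<Longrightarrow> a \<in> T \<Longrightarrow> tree_le T c r a a"
  by (simp add: tree_le_iff two_point)

lemma tree_le_root: "r \<in> T \<Longrightarrow> a \<in> T \<Longrightarrow> tree_le T c r r a"
  unfolding tree_le_iff by (metis sym12 sym23 two_point)

lemma tree_le_antisym:
  assumes "r \<in> T" "tree_le T c r a b" "tree_le T c r b a"
  shows "a = b"
  using assms sym23 unfolding tree_le_iff by metis

lemma tree_le_trans:
  assumes "r \<in> T" "d \<in> T" "tree_le T c r a b" "tree_le T c r b d"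
  shows "tree_le T c r a d"
proof -
  have T: "a \<in> T" "b \<in> T" and "c r a b = a" "c r b d = b"
    using assms sym23 unfolding tree_le_iff by metis+
  then have "c r a d = a"
    using four_point[of r a b d] four_point[of r a d b] four_point[of r b d a]
      three_point[of r a d] assms(1,2)
    by (smt (verit) insert_iff singletonD sym12 sym23)
  then show ?thesis
    using T assms(1,2) sym23 unfolding tree_le_iff by metis
qed

text \<open>The four-point condition for \<open>r\<close>, \<open>a\<close>, \<open>b\<close>,
  \<open>d\<close> forces \<open>c r a b\<close> to be \<open>a\<close> or \<open>b\<close>. This
  turns a common upper bound into comparability.\<close>

lemma tree_le_linear:
  assumes "r \<in> T" "d \<in> T" "tree_le T c r a d" "tree_le T c r b d"
  shows "tree_le T c r a b \<or> tree_le T c r b a"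
proof -
  have T: "a \<in> T" "b \<in> T" and "c r a d = a" "c r b d = b"
    using assms sym23 unfolding tree_le_iff by metis+
  then have "c r a b = a \<or> c r a b = b"
    using four_point[of r a b d] four_point[of r a d b] two_point[of r a] assms(1,2)
    by (smt (verit) insert_iff singletonD sym12 sym23)
  then show ?thesis
    using T assms(1,2) sym23 unfolding tree_le_iff by metis
qed

text \<open>Moves the base point from the root \<open>r\<close> to \<open>a\<close>, so that order
  relations can be used for components at \<open>a\<close>.\<close>

lemma tree_le_between:
  assumes "r \<in> T" "d \<in> T" "tree_le T c r a b" "tree_le T c r b d"
  shows "c a b d = b"
proof -
  have T: "a \<in> T" "b \<in> T" and "c r a b = a" "c r b d = b" "c r a d = a"
    using assms tree_le_trans[OF assms] sym23 unfolding tree_le_iff by metis+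
  then show ?thesis
    using four_point[of r b d a] assms(1,2) two_point[of d a]
    by (smt (verit) insert_iff singletonD sym12 sym23)
qed

lemma tree_component_root:
  assumes "r \<in> T" "x \<in> T" "r \<noteq> x"
  shows "tree_component T c x r = {z \<in> T. \<not> tree_le T c r x z}"
proof -
  have "c x r x = x"
    using assms two_point sym12 sym23 by metis
  moreover have "c x r z = c r z x" if "z \<in> T" for z
    using assms that sym12 sym23 by metis
  ultimately show ?thesis
    using assms unfolding tree_component_def tree_le_iff by auto
qed

section \<open>Open components, closed up-sets and closed intervals\<close>

lemma openin_tree_component:
  assumes "x \<in> T" "y \<in> T" "x \<noteq> y"
  shows "openin (component_topology T c) (tree_component T c x y)"
  unfolding component_topology_def by (rule topology_generated_by_Basis) (use assms in blast)

lemma closedin_up_set: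
  assumes "r \<in> T" "a \<in> T"
  shows "closedin (component_topology T c) {z \<in> T. tree_le T c r a z}"
\<comment> \<open>No component at \<open>r\<close> contains \<open>r\<close>, so the up-set of the
  root is treated separately.\<close>
proof (cases "a = r")
  case True
  then have "{z \<in> T. tree_le T c r a z} = T"
    using assms tree_le_root by blast
  then show ?thesis
    by (metis closedin_topspace topspace_component_topology)
next
  case False
  have "T - tree_component T c a r = {z \<in> T. tree_le T c r a z}"
    using tree_component_root[of r a] assms False by auto
  then show ?thesis
    using openin_tree_component[of a r] assms False
    by (metis closedin_diff closedin_topspace topspace_component_topology)
qed

text \<open>A point \<open>z\<close> off the interval branches from it at
  \<open>w = c r u z\<close>, and the component of \<open>z\<close> at \<open>w\<close> misses the
  interval.\<close>

lemma closedin_tree_interval: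
  assumes "r \<in> T" "u \<in> T"
  shows "closedin (component_topology T c) (tree_interval T c r u)"
proof -
  have "\<exists>U. openin (component_topology T c) U \<and> z \<in> U \<and> U \<subseteq> T - tree_interval T c r u"
    if z: "z \<in> T - tree_interval T c r u" for z
  proof (intro exI conjI)
    define w where "w = c r u z"
    have w: "w \<in> T" "w \<noteq> z" "z \<in> T"
      using assms z by (auto simp: w_def closed tree_interval_def)
    show "openin (component_topology T c) (tree_component T c w z)"
      using w by (intro openin_tree_component)
    show "z \<in> tree_component T c w z"
      using w two_point by (auto simp: tree_component_def)
    \<comment> \<open>As \<open>w\<close> lies between \<open>z\<close> and each of \<open>r\<close>
      and \<open>u\<close>, it also lies between \<open>y\<close> and each of them. With
      \<open>w\<close> in the interval, the four-point condition for \<open>c r u y\<close> leaves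
      only the value \<open>w\<close>.\<close>
    have "False" if y: "y \<in> T" "c r u y = y" "y \<noteq> w" "c w z y \<noteq> w" for y
    proof -
      have "c r z w = w" "c r u w = w" "c u z w = w"
        using three_point assms w sym12 sym23 unfolding w_def by metis+
      then have "c w r z = w" "c w u z = w" "c r u w = w"
        using assms w sym12 sym23 by metis+
      moreover have "c w y z \<noteq> w"
        using y w sym23 by metis
      ultimately have "c w r y = w" "c w u y = w"
        using same_component_trans[of w _ y z] assms w y by blast+
      then have "c r y w = w" "c u y w = w"
        using assms w y sym12 sym23 by metis+
      then show False
        using four_point[of r u y w] assms w y \<open>c r u w = w\<close> by auto
    qed
    then show "tree_component T c w z \<subseteq> T - tree_interval T c r u"
      by (auto simp: tree_component_def tree_interval_def)
  qed
  then have "openin (component_topology T c) (T - tree_interval T c r u)"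
    by (subst openin_subopen) blast
  then show ?thesis
    by (auto simp: closedin_def topspace_component_topology tree_interval_def)
qed

section \<open>Compactness yields suprema of chains\<close>

lemma finite_chain_bound:
  assumes r: "r \<in> T" and A: "A \<subseteq> T" "A \<noteq> {}" "Complete_Partial_Order.chain (tree_le T c r) A"
    and B: "finite B" "B \<subseteq> A"
  shows "\<exists>m\<in>A. \<forall>b\<in>B. tree_le T c r b m"
  using B
proof (induction B rule: finite_induct)
  case empty
  then show ?case using A by blast
next
  case (insert x B)
  then obtain m where m: "m \<in> A" "\<forall>b\<in>B. tree_le T c r b m"
    by auto
  show ?case
  proof (cases "tree_le T c r x m")
    case True
    then show ?thesis using m by auto
  next
    case False
    then have "tree_le T c r m x"
      using A(3) m(1) insert.prems by (auto simp: chain_def)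
    then have "\<forall>b\<in>insert x B. tree_le T c r b x"
      using m(2) tree_le_trans[OF r] tree_le_refl[OF r] insert.prems A(1) by blast
    then show ?thesis using insert.prems by blast
  qed
qed

lemma compact_imp_directed_order_complete:
  assumes "compact_space (component_topology T c)"
  shows "directed_order_complete T c"
  unfolding directed_order_complete_def
proof (intro ballI allI impI, elim conjE)
  fix r A
  assume r: "r \<in> T" and A: "A \<subseteq> T" "A \<noteq> {}" "Complete_Partial_Order.chain (tree_le T c r) A"
  define K where "K a = {z \<in> T. tree_le T c r a z} \<inter>
    (\<Inter>u \<in> {u \<in> T. \<forall>a\<in>A. tree_le T c r a u}. tree_interval T c r u)" for a
  have K: "z \<in> K a \<longleftrightarrow> z \<in> T \<and> tree_le T c r a z \<and>
      (\<forall>u\<in>T. (\<forall>a\<in>A. tree_le T c r a u) \<longrightarrow> tree_le T c r z u)" for a z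
    by (auto simp: K_def tree_le_def)
  have "closedin (component_topology T c) (K a)" if "a \<in> A" for a
  \<comment> \<open>Without upper bounds the indexed intersection is \<open>UNIV\<close>, and
    \<open>K a\<close> is just the up-set of \<open>a\<close>.\<close>
  proof (cases "{u \<in> T. \<forall>a\<in>A. tree_le T c r a u} = {}")
    case True
    then show ?thesis
      unfolding K_def True using closedin_up_set[of r a] r A that by auto
  next
    case False
    then show ?thesis
      unfolding K_def using closedin_up_set[of r a] r A that
      by (intro closedin_Int closedin_INT closedin_tree_interval) auto
  qed
  moreover have "\<Inter>\<F> \<noteq> {}" if fin: "finite \<F>" and sub: "\<F> \<subseteq> K ` A" for \<F>
  proof -
    obtain B where B: "B \<subseteq> A" "finite B" "\<F> = K ` B"
      using finite_subset_image[OF fin sub] by blast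
    \<comment> \<open>Being in \<open>A\<close>, the bound \<open>m\<close> is itself below every
      upper bound of \<open>A\<close>.\<close>
    obtain m where "m \<in> A" "\<forall>b\<in>B. tree_le T c r b m"
      using finite_chain_bound[OF r A B(2,1)] by blast
    then have "m \<in> \<Inter>\<F>"
      using A(1) by (auto simp: B(3) K)
    then show ?thesis by blast
  qed
  ultimately have "\<Inter>(K ` A) \<noteq> {}"
    using assms unfolding compact_space_fip by (metis (no_types, lifting) imageE)
  then obtain s where "s \<in> \<Inter>(K ` A)" by blast
  then have "is_supremum_on T (tree_le T c r) A s"
    unfolding is_supremum_on_def using A(2) by (auto simp: K)
  then show "\<exists>s. is_supremum_on T (tree_le T c r) A s" ..
qed

section \<open>Completeness yields compactness\<close>

lemma directed_order_complete_imp_uncovered: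
  assumes complete: "directed_order_complete T c"
    and comp: "\<And>S. S \<in> \<C> \<Longrightarrow> \<exists>x\<in>T. \<exists>y\<in>T. x \<noteq> y \<and> S = tree_component T c x y"
    and pair: "\<And>S S'. S \<in> \<C> \<Longrightarrow> S' \<in> \<C> \<Longrightarrow> S \<union> S' \<noteq> T"
  shows "\<exists>s\<in>T. s \<notin> \<Union>\<C>"
proof -
  obtain r where r: "r \<in> T" using nonempty by blast
  have meet: "\<exists>z\<in>T. z \<notin> S \<and> z \<notin> S'" if "S \<in> \<C>" "S' \<in> \<C>" for S S'
  proof -
    have "S \<subseteq> T" "S' \<subseteq> T"
      using comp that unfolding tree_component_def by blast+
    then show ?thesis using pair[OF that] by blast
  qed
  \<comment> \<open>Every member of \<open>\<C>\<close> containing \<open>r\<close> has the form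
    \<open>tree_component T c x r\<close> with \<open>x \<in> A\<close>; its complement is the
    up-set of \<open>x\<close>.\<close>
  define A where "A = {x \<in> T. x \<noteq> r \<and> tree_component T c x r \<in> \<C>}"
  have A: "A \<subseteq> T" by (auto simp: A_def)
  have not_in_root_component: "z \<in> T \<Longrightarrow> z \<notin> tree_component T c a r \<longleftrightarrow> tree_le T c r a z"
    if "a \<in> A" for a z
    using that tree_component_root[of r a] r by (auto simp: A_def)
  show ?thesis
  proof (cases "r \<in> \<Union>\<C>")
    case False
    then show ?thesis using r by blast
  next
    case True
    then obtain x y where xy: "x \<in> T" "y \<in> T" "x \<noteq> y" "tree_component T c x y \<in> \<C>"
        "r \<in> tree_component T c x y"
      using comp by blast
    then have "tree_component T c x y = tree_component T c x r"
      using r by (intro tree_component_cong) (auto simp: tree_component_def)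
    then have "x \<in> A"
      using xy by (auto simp: A_def tree_component_def)
    moreover have "Complete_Partial_Order.chain (tree_le T c r) A"
    proof (rule chainI)
      fix a b assume ab: "a \<in> A" "b \<in> A"
      \<comment> \<open>A point missed by both components is a common upper bound of
        \<open>a\<close> and \<open>b\<close>.\<close>
      then obtain z where "z \<in> T" "tree_le T c r a z" "tree_le T c r b z"
        using meet[of "tree_component T c a r" "tree_component T c b r"] not_in_root_component
        by (auto simp: A_def)
      then show "tree_le T c r a b \<or> tree_le T c r b a"
        using tree_le_linear r by blast
    qed
    ultimately obtain s where sup: "is_supremum_on T (tree_le T c r) A s"
      using complete r A unfolding directed_order_complete_def by blast
    then have s: "s \<in> T" "\<And>a. a \<in> A \<Longrightarrow> tree_le T c r a s"
      by (auto simp: is_supremum_on_def)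
    have False if S: "S \<in> \<C>" "s \<in> S" for S
    proof -
      obtain x y where xy: "x \<in> T" "y \<in> T" "x \<noteq> y" "S = tree_component T c x y"
        using comp S by blast
      have "s \<noteq> x" "S = tree_component T c x s"
        using xy S s tree_component_cong[of x y s] by (auto simp: tree_component_def)
      show False
      \<comment> \<open>If \<open>r \<in> S\<close>, the base point \<open>x\<close> is in
        \<open>A\<close>, so \<open>s\<close> is above \<open>x\<close> and outside
        \<open>S\<close>. Otherwise \<open>x\<close> is strictly below \<open>s\<close>, and some
        \<open>a \<in> A\<close> lies strictly above \<open>x\<close>.\<close>
      proof (cases "r \<in> S")
        case True
        then have "S = tree_component T c x r" "x \<noteq> r"
          using xy r tree_component_cong[of x y r] by (auto simp: tree_component_def)
        then have "x \<in> A"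
          using S xy by (auto simp: A_def)
        then show False
          using s S not_in_root_component \<open>S = tree_component T c x r\<close> by blast
      next
        case False
        then have "x = r \<or> c x s r = x"
          using r \<open>S = tree_component T c x s\<close> by (auto simp: tree_component_def)
        then have "tree_le T c r x s"
          using xy(1) r s(1) tree_le_root sym12 sym23 unfolding tree_le_iff by metis
        have "\<not> tree_le T c r s x"
          using \<open>tree_le T c r x s\<close> \<open>s \<noteq> x\<close> tree_le_antisym r by blast
        \<comment> \<open>The least upper bound \<open>s\<close> is not below \<open>x\<close>, so
          \<open>x\<close> is not an upper bound of \<open>A\<close>.\<close>
        then obtain a where a: "a \<in> A" "\<not> tree_le T c r a x"
          using sup xy(1) unfolding is_supremum_on_def by blast
        then have "tree_le T c r x a"
          using tree_le_linear[of r s x a] r s \<open>tree_le T c r x s\<close> by blast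
        \<comment> \<open>\<open>S\<close> and the root component at \<open>a\<close> do not cover
          \<open>T\<close>. Yet the up-set of \<open>a\<close> contains \<open>s\<close> and lies in
          one component at \<open>x\<close>, namely \<open>S\<close>.\<close>
        obtain z where z: "z \<in> T" "z \<notin> S" "tree_le T c r a z"
          using meet[of S "tree_component T c a r"] S a not_in_root_component
          by (auto simp: A_def)
        have "a \<noteq> x"
          using a xy(1) r tree_le_refl by blast
        \<comment> \<open>Since \<open>a \<noteq> x\<close>, both \<open>s\<close> and
          \<open>z\<close> lie in the component of \<open>a\<close> at \<open>x\<close>.\<close>
        have "c x a s = a" "c x a z = a"
          using tree_le_between r s z a \<open>tree_le T c r x a\<close> by blast+
        then have "c x s z \<noteq> x"
          using same_component_trans[of x s a z] sym23 \<open>a \<noteq> x\<close> xy(1) s(1) z(1) a(1) A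
          by (metis subsetD)
        moreover have "z \<noteq> x"
          using z a by blast
        ultimately show False
          using z \<open>S = tree_component T c x s\<close> by (auto simp: tree_component_def)
      qed
    qed
    then show ?thesis using s(1) by blast
  qed
qed

lemma directed_order_complete_imp_compact:
  assumes "directed_order_complete T c"
  shows "compact_space (component_topology T c)"
  unfolding component_topology_def
proof (rule Alexander_subbase_topology_generated_by)
  let ?P = "{tree_component T c x y | x y. x \<in> T \<and> y \<in> T \<and> x \<noteq> y}"
  have T: "\<Union>(insert T ?P) = T"
    by (auto simp: tree_component_def)
  fix \<C> assume sub: "\<C> \<subseteq> insert T ?P" and "\<Union>\<C> = \<Union>(insert T ?P)"
  then have cover: "\<Union>\<C> = T" using T by simp
  show "\<exists>\<C>'. finite \<C>' \<and> \<C>' \<subseteq> \<C> \<and> \<Union>\<C>' = \<Union>(insert T ?P)"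
    unfolding T
  \<comment> \<open>The subbasis contains \<open>T\<close> besides the components. A cover using
    \<open>T\<close> reduces to one member, any other cover to at most two.\<close>
  proof (cases "T \<in> \<C>")
    case True
    then show "\<exists>\<C>'. finite \<C>' \<and> \<C>' \<subseteq> \<C> \<and> \<Union>\<C>' = T"
      by (intro exI[of _ "{T}"]) auto
  next
    case False
    then have "\<exists>x\<in>T. \<exists>y\<in>T. x \<noteq> y \<and> S = tree_component T c x y" if "S \<in> \<C>" for S
      using sub that by blast
    then obtain S S' where "S \<in> \<C>" "S' \<in> \<C>" "S \<union> S' = T"
      using directed_order_complete_imp_uncovered[OF assms, of \<C>] cover by blast
    then show "\<exists>\<C>'. finite \<C>' \<and> \<C>' \<subseteq> \<C> \<and> \<Union>\<C>' = T"
      by (intro exI[of _ "{S, S'}"]) auto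
  qed
qed

end

theorem proposition2p19:
  fixes T :: "'a set" and c :: "'a \<Rightarrow> 'a \<Rightarrow> 'a \<Rightarrow> 'a"
  assumes "algebraic_tree T c"
  shows "compact_space (component_topology T c) \<longleftrightarrow> directed_order_complete T c"
  using algebraic_tree.compact_imp_directed_order_complete[OF assms]
    algebraic_tree.directed_order_complete_imp_compact[OF assms] by blast

end
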